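(* Let $K,T\subset\mathbb{R}^n$ be convex bodies, where $T$ is strictly convex and smooth. Let $q=(q_1,\dots,q_m)$ be an $\ell_T$-minimizing closed $(K,T)$-Minkowski billiard trajectory which fulfills the Minkowski billiard reflection rule with respect to $K$-supporting hyperplanes $H_1,\dots,H_m$, and let $U$ be the convex cone spanned by the outer unit vectors $n_K(q_1),\dots,n_K(q_m)$ normal to $H_1,\dots,H_m$. Then $U$ is a linear subspace of $\mathbb{R}^n$ with $\dim U=m-1$ (in particular $m\le n+1$), and $\dim(N_K(q_j)\cap U)=1$ for all $j\in\{1,\dots,m\}$.
   Context: A convex body in $\mathbb{R}^n$ is a compact convex set containing the origin in its interior. A convex body is smooth if through each boundary point there is a unique supporting hyperplane. For a convex body $T$, $T^\circ$ is its polar body and $\mu_{T^\circ}(x)=\min\{t\ge 0: x\in tT^\circ\}$ (it equals $h_T(x)=\max_{y\in T}\langle x,y\rangle$). For a convex set $C$ and $z\in\partial C$, $N_C(z)=\{v:\langle v,y-z\rangle\le 0\ \forall y\in C\}$ is the outer normal cone; the dimension of a convex cone is that of its linear span. A closed polygonal curve $(q_1,\dots,q_m)$, $m\ge2$, always satisfies $q_j\ne q_{j+1}$ and $q_j\notin[q_{j-1},q_{j+1}]$ (indices mod $m$); its $\ell_T$-length is $\ell_T(q)=\sum_j\mu_{T^\circ}(q_{j+1}-q_j)$. A closed polygonal curve $q=(q_1,\dots,q_m)$ with vertices on $\partial K$ is a closed $(K,T)$-Minkowski billiard trajectory if there are $p_1,\dots,p_m\in\partial T$ with $q_{j+1}-q_j\in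 N_T(p_j)$ and $p_{j+1}-p_j\in -N_K(q_{j+1})$ for all $j$; it fulfills the reflection rule with respect to the $K$-supporting hyperplanes $H_1,\dots,H_m$ through $q_1,\dots,q_m$ if there are outer unit normals $n_K(q_j)\in N_K(q_j)$ normal to $H_j$ and $\mu_j\ge0$ with $p_{j+1}-p_j=-\mu_{j+1}n_K(q_{j+1})$ for all $j$. Such a trajectory is $\ell_T$-minimizing if its $\ell_T$-length is minimal among all closed $(K,T)$-Minkowski billiard trajectories. *)

theory Defs
  imports "HOL-Analysis.Analysis"
begin

definition convex_body :: "'a::euclidean_space set \<Rightarrow> bool" where
  "convex_body K \<longleftrightarrow> compact K \<and> convex K \<and> 0 \<in> interior K"

definition supporting_hyperplane :: "'a::euclidean_space set \<Rightarrow> 'a \<Rightarrow> 'a set \<Rightarrow> bool" where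
  "supporting_hyperplane K z H \<longleftrightarrow>
     (\<exists>v. v \<noteq> 0 \<and> H = {x. v \<bullet> x = v \<bullet> z} \<and> (\<forall>y\<in>K. v \<bullet> y \<le> v \<bullet> z))"

definition smooth_body :: "'a::euclidean_space set \<Rightarrow> bool" where
  "smooth_body K \<longleftrightarrow> (\<forall>z\<in>frontier K. \<exists>!H. supporting_hyperplane K z H)"

definition strictly_convex :: "'a::euclidean_space set \<Rightarrow> bool" where
  "strictly_convex K \<longleftrightarrow>
     (\<forall>x\<in>K. \<forall>y\<in>K. \<forall>t. x \<noteq> y \<and> 0 < t \<and> t < 1 \<longrightarrow> (1 - t) *\<^sub>R x + t *\<^sub>R y \<in> interior K)"

definition polar :: "'a::euclidean_space set \<Rightarrow> 'a set" where
  "polar T = {y. \<forall>x\<in>T. x \<bullet> y \<le> 1}"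

definition gauge :: "'a::euclidean_space set \<Rightarrow> 'a \<Rightarrow> real" where
  "gauge C x = Inf {t. t \<ge> 0 \<and> x \<in> (\<lambda>y. t *\<^sub>R y) ` C}"

definition normal_cone :: "'a::euclidean_space set \<Rightarrow> 'a \<Rightarrow> 'a set" where
  "normal_cone C z = {v. \<forall>y\<in>C. v \<bullet> (y - z) \<le> 0}"

definition closed_polygonal :: "(nat \<Rightarrow> 'a::euclidean_space) \<Rightarrow> nat \<Rightarrow> bool" where
  "closed_polygonal q m \<longleftrightarrow> m \<ge> 2 \<and>
     (\<forall>j<m. q j \<noteq> q (Suc j mod m) \<and>
            q j \<notin> closed_segment (q ((j + m - 1) mod m)) (q (Suc j mod m)))"

definition lengthT :: "'a::euclidean_space set \<Rightarrow> (nat \<Rightarrow> 'a) \<Rightarrow> nat \<Rightarrow> real" where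
  "lengthT T q m = (\<Sum>j<m. gauge (polar T) (q (Suc j mod m) - q j))"

definition billiard_dual :: "'a::euclidean_space set \<Rightarrow> 'a set \<Rightarrow> (nat \<Rightarrow> 'a) \<Rightarrow> nat \<Rightarrow> (nat \<Rightarrow> 'a) \<Rightarrow> bool" where
  "billiard_dual K T q m p \<longleftrightarrow>
     (\<forall>j<m. p j \<in> frontier T \<and>
            q (Suc j mod m) - q j \<in> normal_cone T (p j) \<and>
            p (Suc j mod m) - p j \<in> uminus ` normal_cone K (q (Suc j mod m)))"

definition minkowski_billiard :: "'a::euclidean_space set \<Rightarrow> 'a set \<Rightarrow> (nat \<Rightarrow> 'a) \<Rightarrow> nat \<Rightarrow> bool" where
  "minkowski_billiard K T q m \<longleftrightarrow> closed_polygonal q m \<and> (\<forall>j<m. q j \<in> frontier K) \<and>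
     (\<exists>p. billiard_dual K T q m p)"

definition lT_minimizing :: "'a::euclidean_space set \<Rightarrow> 'a set \<Rightarrow> (nat \<Rightarrow> 'a) \<Rightarrow> nat \<Rightarrow> bool" where
  "lT_minimizing K T q m \<longleftrightarrow> minkowski_billiard K T q m \<and>
     (\<forall>q' m'. minkowski_billiard K T q' m' \<longrightarrow> lengthT T q m \<le> lengthT T q' m')"

definition reflection_rule ::
  "'a::euclidean_space set \<Rightarrow> 'a set \<Rightarrow> (nat \<Rightarrow> 'a) \<Rightarrow> nat \<Rightarrow> (nat \<Rightarrow> 'a set) \<Rightarrow>
   (nat \<Rightarrow> 'a) \<Rightarrow> (nat \<Rightarrow> 'a) \<Rightarrow> (nat \<Rightarrow> real) \<Rightarrow> bool" where
  "reflection_rule K T q m H p nK mu \<longleftrightarrow>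
     billiard_dual K T q m p \<and>
     (\<forall>j<m. supporting_hyperplane K (q j) (H j) \<and>
            nK j \<in> normal_cone K (q j) \<and> norm (nK j) = 1 \<and>
            H j = {x. nK j \<bullet> x = nK j \<bullet> q j} \<and> mu j \<ge> 0 \<and>
            p (Suc j mod m) - p j = - (mu (Suc j mod m) *\<^sub>R nK (Suc j mod m)))"

definition cone_spanned :: "(nat \<Rightarrow> 'a::euclidean_space) \<Rightarrow> nat \<Rightarrow> 'a set" where
  "cone_spanned v m = {(\<Sum>j<m. c j *\<^sub>R v j) | c. \<forall>j<m. c j \<ge> 0}"

end

theory Submission
  imports Defs
begin

text \<open>
  Call a closed polygon translatable if some translate of it lies in the interior of \<open>K\<close>.
  Outer normals \<open>a\<^sub>i\<close> at the vertices that sum to zero, not all zero, prevent translatability,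
  also after any perturbation \<open>d\<close> of the vertices with \<open>\<Sum>a\<^sub>i \<bullet> d\<^sub>i \<ge> 0\<close>. Conversely, a shortest
  non-translatable polygon with as few vertices as possible carries such normals, and the
  first-order condition for its length makes it a billiard trajectory. Hence a minimizing trajectory
  is no longer than any non-translatable polygon. The first-order condition then applies to the
  trajectory with every choice of normals \<open>a\<^sub>i\<close> summing to zero, and shows that
  they are proportional to \<open>\<mu>\<^sub>i n\<^sub>i\<close>: up to scaling there is only one relation, and all its
  coefficients \<open>\<mu>\<^sub>i\<close> are positive since \<open>T\<close> is smooth. All assertions are consequences of this.
\<close>

section \<open>Support functions and normal cones\<close>

text \<open>The gauge of the polar body is the support function of \<open>T\<close>.\<close>

lemma gauge_polar_attained:
  fixes T :: "'a::euclidean_space set"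
  assumes "convex_body T"
  shows "\<exists>p\<in>T. x \<bullet> p = gauge (polar T) x \<and> (\<forall>y\<in>T. x \<bullet> y \<le> gauge (polar T) x)"
proof -
  have cT: "compact T" and T0: "0 \<in> interior T" using assms by (auto simp: convex_body_def)
  have "0 \<in> T" using T0 interior_subset by blast
  moreover have "continuous_on T (\<lambda>y. x \<bullet> y)" by (intro continuous_intros)
  ultimately obtain p where p: "p \<in> T" "\<And>y. y \<in> T \<Longrightarrow> x \<bullet> y \<le> x \<bullet> p"
    using continuous_attains_sup[OF cT, of "\<lambda>y. x \<bullet> y"] by blast
  have "gauge (polar T) x = x \<bullet> p"
    unfolding gauge_def
  proof (rule cInf_eq_minimum)
    have "0 \<le> x \<bullet> p" using p(2)[OF \<open>0 \<in> T\<close>] by simp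
    moreover have "x \<in> (*\<^sub>R) (x \<bullet> p) ` polar T"
    proof (cases "x = 0")
      case True
      then show ?thesis by (auto simp: polar_def intro!: image_eqI[of _ _ 0])
    next
      case False
      \<comment> \<open>A small multiple of \<open>x\<close> lies in \<open>T\<close>, so the
        maximum \<open>x \<bullet> p\<close> is positive and may be divided by.\<close>
      obtain e where e: "e > 0" "ball 0 e \<subseteq> T" using T0 by (auto simp: mem_interior)
      have "(e / 2 / norm x) *\<^sub>R x \<in> T" using e False by (intro subsetD[OF e(2)]) auto
      then have "(e / 2 / norm x) * (x \<bullet> x) \<le> x \<bullet> p" using p(2) by fastforce
      moreover have "(e / 2 / norm x) * (x \<bullet> x) > 0" using e False by simp
      ultimately have pos: "x \<bullet> p > 0" by linarith
      have "(1 / (x \<bullet> p)) *\<^sub>R x \<in> polar T"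
        using p(2) pos by (auto simp: polar_def divide_simps inner_commute)
      then show ?thesis using pos by (intro image_eqI[of _ _ "(1 / (x \<bullet> p)) *\<^sub>R x"]) auto
    qed
    ultimately show "x \<bullet> p \<in> {t. 0 \<le> t \<and> x \<in> (*\<^sub>R) t ` polar T}" by simp
  next
    fix t assume "t \<in> {t. 0 \<le> t \<and> x \<in> (*\<^sub>R) t ` polar T}"
    then obtain w where t: "0 \<le> t" "x = t *\<^sub>R w" "w \<in> polar T" by auto
    then have "w \<bullet> p \<le> 1" using p(1) by (auto simp: polar_def inner_commute)
    then show "x \<bullet> p \<le> t" using t by (simp add: mult_left_le)
  qed
  then show ?thesis using p by metis
qed

lemma inner_le_gauge_polar:
  fixes T :: "'a::euclidean_space set"
  assumes "convex_body T" "y \<in> T"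
  shows "x \<bullet> y \<le> gauge (polar T) x"
  using gauge_polar_attained[OF assms(1)] assms(2) by blast

lemma gauge_polar_triangle:
  fixes T :: "'a::euclidean_space set"
  assumes "convex_body T"
  shows "gauge (polar T) (x + y) \<le> gauge (polar T) x + gauge (polar T) y"
proof -
  obtain p where "p \<in> T" "(x + y) \<bullet> p = gauge (polar T) (x + y)"
    using gauge_polar_attained[OF assms] by blast
  then show ?thesis
    using inner_le_gauge_polar[OF assms, of p x] inner_le_gauge_polar[OF assms, of p y]
    by (simp add: inner_add_left)
qed

lemma gauge_polar_zero:
  fixes T :: "'a::euclidean_space set"
  assumes "convex_body T"
  shows "gauge (polar T) 0 = 0"
  using gauge_polar_attained[OF assms, of 0] by auto

lemma gauge_polar_scaleR:
  fixes T :: "'a::euclidean_space set"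
  assumes "convex_body T" "c \<ge> 0"
  shows "gauge (polar T) (c *\<^sub>R x) = c * gauge (polar T) x"
proof (rule antisym)
  obtain p where "p \<in> T" "(c *\<^sub>R x) \<bullet> p = gauge (polar T) (c *\<^sub>R x)"
    using gauge_polar_attained[OF assms(1)] by blast
  then show "gauge (polar T) (c *\<^sub>R x) \<le> c * gauge (polar T) x"
    using inner_le_gauge_polar[OF assms(1), of p x] assms(2) by (metis inner_scaleR_left mult_left_mono)
  obtain p where "p \<in> T" "x \<bullet> p = gauge (polar T) x"
    using gauge_polar_attained[OF assms(1)] by blast
  then show "c * gauge (polar T) x \<le> gauge (polar T) (c *\<^sub>R x)"
    using inner_le_gauge_polar[OF assms(1), of p "c *\<^sub>R x"] by (simp add: inner_scaleR_left)
qed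

text \<open>A ball around 0 inside \<open>T\<close> supplies a test point in direction
  \<open>x\<close>. The bound keeps polygons of bounded length bounded up to translation.\<close>

lemma gauge_polar_ge_norm:
  fixes T :: "'a::euclidean_space set"
  assumes "convex_body T"
  shows "\<exists>r>0. \<forall>x. r * norm x \<le> gauge (polar T) x"
proof -
  obtain e where e: "e > 0" "cball 0 e \<subseteq> T"
    using assms by (auto simp: convex_body_def mem_interior_cball)
  have "e * norm x \<le> gauge (polar T) x" for x
  proof (cases "x = 0")
    case True
    then show ?thesis using gauge_polar_zero[OF assms] by simp
  next
    case False
    have "(e / norm x) *\<^sub>R x \<in> T" using e False by (intro subsetD[OF e(2)]) auto
    from inner_le_gauge_polar[OF assms this, of x] False show ?thesis
      by (simp add: dot_square_norm power2_eq_square)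
  qed
  then show ?thesis using e by blast
qed

lemma gauge_polar_nonneg:
  fixes T :: "'a::euclidean_space set"
  assumes "convex_body T"
  shows "gauge (polar T) x \<ge> 0"
proof -
  obtain r where "r > 0" "r * norm x \<le> gauge (polar T) x" using gauge_polar_ge_norm[OF assms] by blast
  moreover have "0 \<le> r * norm x" using \<open>r > 0\<close> by simp
  ultimately show ?thesis by linarith
qed

lemma continuous_on_gauge_polar:
  fixes T :: "'a::euclidean_space set"
  assumes "convex_body T"
  shows "continuous_on UNIV (gauge (polar T))"
proof (rule convex_on_continuous)
  show "convex_on UNIV (gauge (polar T))"
  proof (rule convex_onI)
    fix t :: real and x y :: 'a assume "0 < t" "t < 1"
    then show "gauge (polar T) ((1 - t) *\<^sub>R x + t *\<^sub>R y)
        \<le> (1 - t) * gauge (polar T) x + t * gauge (polar T) y"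
      using gauge_polar_triangle[OF assms, of "(1 - t) *\<^sub>R x" "t *\<^sub>R y"]
      by (simp add: gauge_polar_scaleR[OF assms])
  qed simp
qed auto

section \<open>Outer normals and maximizers of linear functionals\<close>

text \<open>A small step from \<open>z\<close> in direction \<open>v\<close> stays in
  \<open>K\<close> and strictly increases the functional, whose maximum over \<open>K\<close> is at
  most \<open>v \<bullet> y\<close>.\<close>

lemma normal_cone_interior_less:
  fixes K :: "'a::euclidean_space set"
  assumes "v \<in> normal_cone K y" "v \<noteq> 0" "z \<in> interior K"
  shows "v \<bullet> z < v \<bullet> y"
proof -
  obtain e where e: "e > 0" "cball z e \<subseteq> K" using assms(3) by (auto simp: mem_interior_cball)
  have "z + (e / norm v) *\<^sub>R v \<in> K" using e assms(2) by (intro subsetD[OF e(2)]) (auto simp: dist_norm)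
  then have "v \<bullet> (z + (e / norm v) *\<^sub>R v - y) \<le> 0" using assms(1) by (auto simp: normal_cone_def)
  moreover have "v \<bullet> ((e / norm v) *\<^sub>R v) > 0" using e assms(2) by simp
  ultimately show ?thesis by (simp add: inner_diff_right inner_add_right)
qed

lemma normal_cone_frontier:
  fixes K :: "'a::euclidean_space set"
  assumes "v \<in> normal_cone K y" "v \<noteq> 0" "y \<in> K"
  shows "y \<in> frontier K"
  using normal_cone_interior_less[OF assms(1,2), of y] assms(3) closure_subset
  by (auto simp: frontier_def)

lemma normal_cone_zero: "0 \<in> normal_cone K y"
  by (simp add: normal_cone_def)

lemma normal_cone_add:
  "v \<in> normal_cone K y \<Longrightarrow> w \<in> normal_cone K y \<Longrightarrow> v + w \<in> normal_cone K y"
  by (fastforce simp: normal_cone_def inner_add_left)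

lemma normal_cone_scaleR:
  "v \<in> normal_cone K y \<Longrightarrow> c \<ge> 0 \<Longrightarrow> c *\<^sub>R v \<in> normal_cone K y"
  by (auto simp: normal_cone_def mult_nonneg_nonpos)

lemma normal_cone_sum:
  "finite S \<Longrightarrow> (\<And>v. v \<in> S \<Longrightarrow> f v \<in> normal_cone K y) \<Longrightarrow> (\<Sum>v\<in>S. f v) \<in> normal_cone K y"
  by (induction S rule: finite_induct) (auto intro: normal_cone_zero normal_cone_add)

lemma normal_cone_iff_gauge_polar:
  fixes T :: "'a::euclidean_space set"
  assumes "convex_body T" "p \<in> T"
  shows "x \<in> normal_cone T p \<longleftrightarrow> x \<bullet> p = gauge (polar T) x"
proof
  assume x: "x \<in> normal_cone T p"
  obtain p' where "p' \<in> T" "x \<bullet> p' = gauge (polar T) x" using gauge_polar_attained[OF assms(1)] by blast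
  then show "x \<bullet> p = gauge (polar T) x"
    using x inner_le_gauge_polar[OF assms, of x] by (fastforce simp: normal_cone_def inner_diff_right)
next
  assume "x \<bullet> p = gauge (polar T) x"
  then show "x \<in> normal_cone T p"
    using inner_le_gauge_polar[OF assms(1), of _ x] by (simp add: normal_cone_def inner_diff_right)
qed

text \<open>The midpoint of two distinct maximizers would be an interior point, where a nonzero
  functional cannot be maximal.\<close>

lemma strictly_convex_maximizer_unique:
  fixes T :: "'a::euclidean_space set"
  assumes "strictly_convex T" "e \<noteq> 0" "p \<in> T" "p' \<in> T" "e \<in> normal_cone T p" "e \<in> normal_cone T p'"
  shows "p = p'"
proof (rule ccontr)
  assume "p \<noteq> p'"
  then have "(1 - 1/2) *\<^sub>R p + (1/2) *\<^sub>R p' \<in> interior T"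
    using assms(1)[unfolded strictly_convex_def, rule_format, OF assms(3,4), of "1/2"] by simp
  from normal_cone_interior_less[OF assms(5,2) this]
  have "e \<bullet> p' < e \<bullet> p" by (simp add: inner_add_right algebra_simps)
  then show False using assms(6,3) by (force simp: normal_cone_def inner_diff_right)
qed

text \<open>Both normals define the unique supporting hyperplane at \<open>p\<close>, so they have
  the same kernel and are proportional. Both are positive on \<open>p\<close> since 0 is interior,
  hence the factor is positive.\<close>

lemma smooth_normal_cone_ray:
  fixes T :: "'a::euclidean_space set"
  assumes "convex_body T" "smooth_body T" "p \<in> frontier T"
    and v: "v \<in> normal_cone T p" "v \<noteq> 0" and w: "w \<in> normal_cone T p" "w \<noteq> 0"
  shows "\<exists>c>0. w = c *\<^sub>R v"
proof -
  have T0: "0 \<in> interior T" using assms by (auto simp: convex_body_def)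
  have "supporting_hyperplane T p {x. u \<bullet> x = u \<bullet> p}" if "u \<in> normal_cone T p" "u \<noteq> 0" for u
    unfolding supporting_hyperplane_def using that
    by (intro exI[of _ u]) (auto simp: normal_cone_def inner_diff_right)
  then have eq: "{x. v \<bullet> x = v \<bullet> p} = {x. w \<bullet> x = w \<bullet> p}"
    using assms(2,3) v w unfolding smooth_body_def by blast
  have vp: "v \<bullet> p > 0" "w \<bullet> p > 0"
    using normal_cone_interior_less[OF v T0] normal_cone_interior_less[OF w T0] by auto
  define c where "c = (w \<bullet> p) / (v \<bullet> p)"
  have orth: "w \<bullet> x = 0" if "v \<bullet> x = 0" for x
  proof -
    have "p + x \<in> {x. v \<bullet> x = v \<bullet> p}" using that by (simp add: inner_add_right)
    then have "p + x \<in> {x. w \<bullet> x = w \<bullet> p}" using eq by simp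
    then show ?thesis by (simp add: inner_add_right)
  qed
  have "(w - c *\<^sub>R v) \<bullet> x = 0" for x
  proof -
    \<comment> \<open>Subtracting a suitable multiple of \<open>p\<close> moves \<open>x\<close>
      into the kernel of \<open>v\<close>.\<close>
    have "v \<bullet> (x - ((v \<bullet> x) / (v \<bullet> p)) *\<^sub>R p) = 0" using vp by (simp add: inner_diff_right)
    from orth[OF this] have "w \<bullet> x = (v \<bullet> x) / (v \<bullet> p) * (w \<bullet> p)" by (simp add: inner_diff_right)
    then show ?thesis by (simp add: inner_diff_left c_def)
  qed
  then have "w - c *\<^sub>R v = 0" by (metis inner_eq_zero_iff)
  then show ?thesis using vp by (intro exI[of _ c]) (auto simp: c_def)
qed

section \<open>Closed polygons and translations into the interior\<close>

lemma sum_cyclic_shift: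
  fixes f :: "nat \<Rightarrow> 'b::comm_monoid_add"
  shows "(\<Sum>j<m. f (Suc j mod m)) = (\<Sum>j<m. f j)"
proof (cases m)
  case (Suc n)
  have "(\<Sum>j<m. f (Suc j mod m)) = (\<Sum>j<n. f (Suc j mod m)) + f 0"
    by (simp add: Suc)
  also have "(\<Sum>j<n. f (Suc j mod m)) = (\<Sum>j<n. f (Suc j))"
    by (intro sum.cong) (auto simp: Suc)
  also have "(\<Sum>j<n. f (Suc j)) + f 0 = (\<Sum>j<m. f j)"
    by (simp only: Suc sum.lessThan_Suc_shift add.commute)
  finally show ?thesis .
qed simp

text \<open>Cyclic successors exhaust the indices below \<open>m\<close>; this transfers facts that
  the reflection rule gives only at \<open>Suc j mod m\<close>.\<close>

lemma all_cyclic_succ: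
  assumes "\<And>j. j < m \<Longrightarrow> P (Suc j mod m)" "i < m"
  shows "P i"
proof (cases i)
  case 0
  then show ?thesis using assms(1)[of "m - 1"] assms(2) by simp
next
  case (Suc k)
  then show ?thesis using assms(1)[of k] assms(2) by simp
qed

lemma lengthT_translate: "lengthT T (\<lambda>i. y i + t) m = lengthT T y m"
  by (simp add: lengthT_def)

lemma lengthT_cong:
  assumes "\<And>i. i < m \<Longrightarrow> y i = z i"
  shows "lengthT T y m = lengthT T z m"
  unfolding lengthT_def using assms by (intro sum.cong) auto

lemma lengthT_scaleR:
  fixes T :: "'a::euclidean_space set"
  assumes "convex_body T" "c \<ge> 0"
  shows "lengthT T (\<lambda>i. c *\<^sub>R y i) m = c * lengthT T y m"
  by (simp add: lengthT_def sum_distrib_left gauge_polar_scaleR[OF assms] flip: scaleR_diff_right)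

lemma lengthT_rotate: "lengthT T (\<lambda>k. y ((k + c) mod m)) m = lengthT T y m"
proof (induction c)
  case 0
  show ?case by (rule lengthT_cong) simp
next
  case (Suc c)
  define z where "z = (\<lambda>k. y ((k + c) mod m))"
  have "lengthT T (\<lambda>k. y ((k + Suc c) mod m)) m = lengthT T (\<lambda>k. z (Suc k mod m)) m"
    by (rule lengthT_cong) (simp add: z_def mod_add_left_eq)
  also have "\<dots> = lengthT T z m"
    unfolding lengthT_def
    using sum_cyclic_shift[of "\<lambda>j. gauge (polar T) (z (Suc j mod m) - z j)" m] by simp
  finally show ?case using Suc by (simp add: z_def)
qed

lemma lengthT_Suc:
  "lengthT T y (Suc n) = (\<Sum>j<n. gauge (polar T) (y (Suc j) - y j)) + gauge (polar T) (y 0 - y n)"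
  by (simp add: lengthT_def)

text \<open>The triangle inequality replaces the two edges at the last vertex by one. Any other
  vertex can first be rotated into last position.\<close>

lemma lengthT_drop_last:
  fixes T :: "'a::euclidean_space set"
  assumes "convex_body T"
  shows "lengthT T y (Suc n) \<le> lengthT T y (Suc (Suc n))"
  using gauge_polar_triangle[OF assms, of "y (Suc n) - y n" "y 0 - y (Suc n)"]
  by (simp add: lengthT_Suc)

text \<open>The path along the polygon from \<open>y 0\<close> to \<open>y i\<close> is at least as
  long as its chord.\<close>

lemma norm_diff_le_lengthT:
  fixes T :: "'a::euclidean_space set"
  assumes "convex_body T" and r: "r > 0" "\<And>x. r * norm x \<le> gauge (polar T) x" and "i < m"
  shows "norm (y i - y 0) \<le> lengthT T y m / r"
proof -
  obtain n where m: "m = Suc n" using \<open>i < m\<close> by (cases m) auto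
  have "r * norm (y i - y 0) \<le> gauge (polar T) (y i - y 0)" by (rule r)
  also have "\<dots> \<le> (\<Sum>j<i. gauge (polar T) (y (Suc j) - y j))"
  proof (induction i)
    case (Suc i)
    then show ?case using gauge_polar_triangle[OF assms(1), of "y (Suc i) - y i" "y i - y 0"] by simp
  qed (simp add: gauge_polar_zero[OF assms(1)])
  also have "\<dots> \<le> (\<Sum>j<n. gauge (polar T) (y (Suc j) - y j))"
    using \<open>i < m\<close> m by (intro sum_mono2) (auto intro: gauge_polar_nonneg[OF assms(1)])
  also have "\<dots> \<le> lengthT T y m"
    using gauge_polar_nonneg[OF assms(1)] by (simp add: m lengthT_Suc)
  finally show ?thesis using r(1) by (simp add: field_simps)
qed

lemma continuous_on_lengthT:
  fixes T :: "'a::euclidean_space set"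
  assumes "convex_body T"
  shows "continuous_on UNIV (\<lambda>y. lengthT T y m)"
  unfolding lengthT_def
  by (intro continuous_on_sum continuous_on_compose2[OF continuous_on_gauge_polar[OF assms]]
      continuous_intros continuous_on_product_coordinates) auto

section \<open>Polygons with a translate in the interior of \<open>K\<close>\<close>

text \<open>No polygonal condition is imposed on \<open>y\<close>, so vertices can be perturbed or
  dropped freely. Asking for the interior makes the property open in \<open>y\<close>.\<close>

definition translatable :: "'a::euclidean_space set \<Rightarrow> (nat \<Rightarrow> 'a) \<Rightarrow> nat \<Rightarrow> bool" where
  "translatable K y m \<longleftrightarrow> (\<exists>t. \<forall>i<m. y i + t \<in> interior K)"

lemma translatable_translate: "translatable K (\<lambda>i. y i + s) m \<longleftrightarrow> translatable K y m"
proof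
  assume "translatable K y m"
  then obtain t where "\<forall>i<m. y i + t \<in> interior K" by (auto simp: translatable_def)
  then show "translatable K (\<lambda>i. y i + s) m"
    unfolding translatable_def by (intro exI[of _ "t - s"]) simp
qed (auto simp: translatable_def add.assoc)

lemma translatable_cong:
  "(\<And>i. i < m \<Longrightarrow> y i = z i) \<Longrightarrow> translatable K y m \<longleftrightarrow> translatable K z m"
  by (simp add: translatable_def)

lemma open_translatable: "open {y. translatable K y m}"
proof -
  have "{y. translatable K y m} = (\<Union>t. \<Inter>i\<in>{..<m}. (\<lambda>y. y i + t) -` interior K)"
    by (auto simp: translatable_def)
  moreover have "open ((\<lambda>y. y i + t) -` interior K)" for i :: nat and t
    by (intro open_vimage continuous_intros continuous_on_product_coordinates) auto
  ultimately show ?thesis by (auto intro!: open_INT)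
qed

text \<open>A translation \<open>t\<close> into the interior would give
  \<open>a i \<bullet> (d i + t) < 0\<close> for every nonzero \<open>a i\<close>. In the sum over
  all \<open>i\<close> the part with \<open>t\<close> cancels, which contradicts the assumption on
  \<open>d\<close>.\<close>

lemma normals_imp_not_translatable:
  fixes K :: "'a::euclidean_space set"
  assumes a: "\<And>i. i < m \<Longrightarrow> a i \<in> normal_cone K (y i)" "(\<Sum>i<m. a i) = 0"
    and nz: "\<exists>i<m. a i \<noteq> 0" and d: "(\<Sum>i<m. a i \<bullet> d i) \<ge> 0"
  shows "\<not> translatable K (\<lambda>i. y i + d i) m"
proof
  assume "translatable K (\<lambda>i. y i + d i) m"
  then obtain t where t: "\<And>i. i < m \<Longrightarrow> y i + d i + t \<in> interior K" by (auto simp: translatable_def)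
  obtain k where k: "k < m" "a k \<noteq> 0" using nz by blast
  have "a i \<bullet> (d i + t) < 0" if "i < m" "a i \<noteq> 0" for i
    using normal_cone_interior_less[OF a(1) _ t, of i i] that by (simp add: inner_add_right)
  then have "(\<Sum>i<m. a i \<bullet> (d i + t)) < (\<Sum>i<m. 0)"
    using k by (intro sum_strict_mono_ex1) (auto, metis inner_zero_left less_imp_le order_refl)
  moreover have "(\<Sum>i<m. a i \<bullet> (d i + t)) = (\<Sum>i<m. a i \<bullet> d i) + (\<Sum>i<m. a i) \<bullet> t"
    by (simp add: inner_add_right sum.distrib inner_sum_left)
  ultimately show False using d a(2) by simp
qed

text \<open>Length and translatability are invariant under translation, so the first vertex may be
  put at 0. Bounded length then confines the polygon to a compact set, on which the length is
  continuous and non-translatability is closed.\<close>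

lemma shortest_not_translatable_exists:
  fixes K T :: "'a::euclidean_space set"
  assumes T: "convex_body T" and y0: "\<not> translatable K y0 m"
  shows "\<exists>y. \<not> translatable K y m \<and> (\<forall>z. \<not> translatable K z m \<longrightarrow> lengthT T y m \<le> lengthT T z m)"
proof -
  obtain r where r: "r > 0" "\<And>x. r * norm x \<le> gauge (polar T) x" using gauge_polar_ge_norm[OF T] by blast
  define B where "B = lengthT T y0 m"
  \<comment> \<open>Only the coordinates below \<open>m\<close> matter; the others are pinned to 0
    so that every factor of the product is compact.\<close>
  define C where "C = Pi\<^sub>E UNIV (\<lambda>i::nat. if i < m then cball (0::'a) (B / r) else {0})"
  have cC: "compact C"
    unfolding C_def using compactin_PiE[of "\<lambda>i. euclidean :: 'a topology" "UNIV :: nat set"]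
    by (simp add: euclidean_product_topology flip: compactin_euclidean_iff) simp
  define N where "N z = (\<lambda>i. if i < m then z i - z 0 else 0)" for z :: "nat \<Rightarrow> 'a"
  have N_len: "lengthT T (N z) m = lengthT T z m" for z
    using lengthT_cong[of m "N z" "\<lambda>i. z i + (- z 0)" T] by (simp add: N_def lengthT_translate del: add_uminus_conv_diff)
  have N_tr: "translatable K (N z) m \<longleftrightarrow> translatable K z m" for z
    using translatable_cong[of m "N z" "\<lambda>i. z i + (- z 0)" K]
    by (simp add: N_def translatable_translate del: add_uminus_conv_diff)
  have N_C: "N z \<in> C" if "lengthT T z m \<le> B" for z
  proof -
    have "norm (z i - z 0) \<le> B / r" if "i < m" for i
    proof -
      have "norm (z i - z 0) \<le> lengthT T z m / r"
        by (rule norm_diff_le_lengthT[OF T r that])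
      also have "\<dots> \<le> B / r" using \<open>lengthT T z m \<le> B\<close> r(1) by (simp add: divide_right_mono)
      finally show ?thesis .
    qed
    then show ?thesis by (auto simp: C_def N_def)
  qed
  let ?S = "C \<inter> - {y. translatable K y m}"
  have "compact ?S" using cC open_translatable by (intro compact_Int_closed) auto
  moreover have "N y0 \<in> ?S" using N_C[of y0] N_tr y0 by (auto simp: B_def)
  moreover have "continuous_on ?S (\<lambda>y. lengthT T y m)"
    using continuous_on_lengthT[OF T] continuous_on_subset by blast
  ultimately obtain y where y: "y \<in> ?S" "\<And>z. z \<in> ?S \<Longrightarrow> lengthT T y m \<le> lengthT T z m"
    using continuous_attains_inf[of ?S "\<lambda>y. lengthT T y m"] by blast
  have "lengthT T y m \<le> lengthT T z m" if "\<not> translatable K z m" for z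
  proof (cases "lengthT T z m \<le> B")
    case True
    then show ?thesis using y(2)[of "N z"] N_C[OF True] N_tr[of z] that by (simp add: N_len)
  next
    case False
    then show ?thesis using y(2)[OF \<open>N y0 \<in> ?S\<close>] by (simp add: N_len B_def)
  qed
  then show ?thesis using y(1) by blast
qed

section \<open>Normals at a non-translatable polygon\<close>

text \<open>If the open ray from \<open>y\<close> in direction \<open>t\<close> missed the interior,
  a hyperplane separating the two would yield a nonzero normal at \<open>y\<close> with nonnegative
  value on \<open>t\<close>.\<close>

lemma enters_interior:
  fixes K :: "'a::euclidean_space set"
  assumes K: "convex_body K" and y: "y \<in> K"
    and t: "\<And>v. v \<in> normal_cone K y \<Longrightarrow> v \<noteq> 0 \<Longrightarrow> v \<bullet> t < 0"
  shows "\<exists>s>0. y + s *\<^sub>R t \<in> interior K"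
proof (rule ccontr)
  assume no: "\<not> ?thesis"
  have cK: "convex K" and clK: "closed K" and K0: "0 \<in> interior K"
    using K by (auto simp: convex_body_def compact_imp_closed)
  define R where "R = (\<lambda>s. y + s *\<^sub>R t) ` {0<..}"
  have "convex R"
  proof -
    have "R = (\<lambda>x. y + x) ` ((\<lambda>s. s *\<^sub>R t) ` {0<..})" by (auto simp: R_def image_image)
    then show ?thesis
      by (simp add: convex_linear_image linear_scaleR_left convex_real_interval)
  qed
  moreover have "R \<inter> interior K = {}" using no by (auto simp: R_def)
  moreover have "R \<noteq> {}" by (auto simp: R_def)
  ultimately obtain w b where w: "w \<noteq> 0" "\<And>x. x \<in> interior K \<Longrightarrow> w \<bullet> x \<le> b" "\<And>x. x \<in> R \<Longrightarrow> b \<le> w \<bullet> x"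
    using separating_hyperplane_sets[of "interior K" R] convex_interior[OF cK] K0
    by (metis Int_commute empty_iff)
  have "closure (interior K) = K"
    using convex_closure_interior[OF cK] K0 clK by auto
  moreover have "closure (interior K) \<subseteq> {x. w \<bullet> x \<le> b}"
    using w(2) by (intro closure_minimal closed_halfspace_le) auto
  ultimately have wK: "w \<bullet> x \<le> b" if "x \<in> K" for x using that by auto
  have wR: "b \<le> w \<bullet> y + s * (w \<bullet> t)" if "s > 0" for s
    using w(3)[of "y + s *\<^sub>R t"] that by (auto simp: R_def inner_add_right)
  \<comment> \<open>As \<open>s\<close> tends to 0 the ray approaches \<open>y\<close>, which
    therefore lies on the separating hyperplane.\<close>
  have "((\<lambda>s. w \<bullet> y + s * (w \<bullet> t)) \<longlongrightarrow> w \<bullet> y + 0 * (w \<bullet> t)) (at_right 0)"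
    by (intro tendsto_intros)
  moreover have "\<forall>\<^sub>F s in at_right 0. b \<le> w \<bullet> y + s * (w \<bullet> t)"
    using wR by (auto simp: eventually_at_right_field intro: exI[of _ 1])
  ultimately have "b \<le> w \<bullet> y" using tendsto_lowerbound by fastforce
  then have wy: "w \<bullet> y = b" using wK[OF y] by simp
  then have "w \<in> normal_cone K y" using wK by (simp add: normal_cone_def inner_diff_right)
  from t[OF this w(1)] wR[of 1] wy show False by simp
qed

text \<open>The translation vectors for factors tending to 1 are bounded, and a limit of a
  subsequence works for \<open>y\<close> itself. In the limit only membership in the closed set
  \<open>K\<close> survives.\<close>

lemma translates_into_body:
  fixes K :: "'a::euclidean_space set"
  assumes K: "convex_body K" and tr: "\<And>c. 0 < c \<Longrightarrow> c < 1 \<Longrightarrow> translatable K (\<lambda>i. c *\<^sub>R y i) m"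
  shows "\<exists>t. \<forall>i<m. y i + t \<in> K"
proof (cases "m = 0")
  case False
  have cK: "compact K" using K by (auto simp: convex_body_def)
  then obtain R where R: "\<And>x. x \<in> K \<Longrightarrow> norm x \<le> R" using compact_imp_bounded bounded_iff by metis
  \<comment> \<open>The shift by 2 keeps every factor strictly between 0 and 1.\<close>
  define c where "c k = 1 - 1 / real (k + 2)" for k
  have c: "0 < c k" "c k < 1" for k by (auto simp: c_def)
  have c_lim: "c \<longlonglongrightarrow> 1"
  proof -
    have "(\<lambda>k. 1 - 1 / real (k + 2)) \<longlonglongrightarrow> 1 - 0"
      using LIMSEQ_ignore_initial_segment[OF lim_1_over_n, of 2] by (intro tendsto_intros) auto
    then show ?thesis by (simp add: c_def[abs_def])
  qed
  have "\<forall>k. \<exists>t. \<forall>i<m. c k *\<^sub>R y i + t \<in> K"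
    using tr[OF c] interior_subset unfolding translatable_def by blast
  then obtain t where t: "\<And>k i. i < m \<Longrightarrow> c k *\<^sub>R y i + t k \<in> K" by metis
  have "t k \<in> cball 0 (R + norm (y 0))" for k
  proof -
    have "norm (t k) \<le> norm (c k *\<^sub>R y 0 + t k) + norm (c k *\<^sub>R y 0)"
      by (metis add_diff_cancel_left' norm_triangle_ineq4)
    also have "\<dots> \<le> R + norm (y 0)"
      using R[OF t[of 0 k]] False c[of k] by (intro add_mono) (auto intro: mult_left_le_one_le)
    finally show ?thesis by simp
  qed
  then obtain l \<sigma> where \<sigma>: "strict_mono \<sigma>" "(t \<circ> \<sigma>) \<longlonglongrightarrow> l"
    using compact_cball[of "0::'a" "R + norm (y 0)"] unfolding compact_def by metis
  have "y i + l \<in> K" if "i < m" for i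
  proof (rule closed_sequentially[OF compact_imp_closed[OF cK]])
    show "(c \<circ> \<sigma>) k *\<^sub>R y i + (t \<circ> \<sigma>) k \<in> K" for k using t[OF that] by simp
    have "(\<lambda>k. (c \<circ> \<sigma>) k *\<^sub>R y i + (t \<circ> \<sigma>) k) \<longlonglongrightarrow> 1 *\<^sub>R y i + l"
      using LIMSEQ_subseq_LIMSEQ[OF c_lim \<sigma>(1)] \<sigma>(2) by (intro tendsto_intros)
    then show "(\<lambda>k. (c \<circ> \<sigma>) k *\<^sub>R y i + (t \<circ> \<sigma>) k) \<longlonglongrightarrow> y i + l" by simp
  qed
  then show ?thesis by blast
qed simp

text \<open>The normalization is linear in \<open>v\<close>, so the set is an intersection of closed
  half-spaces and a hyperplane. A ball of radius \<open>e\<close> in \<open>K\<close> bounds the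
  norm of its elements by \<open>1 / e\<close>.\<close>

lemma compact_normalized_normals:
  fixes K :: "'a::euclidean_space set"
  assumes "convex_body K"
  shows "compact {v \<in> normal_cone K y. v \<bullet> y = 1}"
proof -
  obtain e where e: "e > 0" "cball 0 e \<subseteq> K"
    using assms by (auto simp: convex_body_def mem_interior_cball)
  have "norm v \<le> 1 / e" if v: "v \<in> normal_cone K y" "v \<bullet> y = 1" for v
  proof (cases "v = 0")
    case False
    have "(e / norm v) *\<^sub>R v \<in> K" using e False by (intro subsetD[OF e(2)]) auto
    then have "v \<bullet> ((e / norm v) *\<^sub>R v) \<le> 1" using v by (force simp: normal_cone_def inner_diff_right)
    then show ?thesis using False e(1) by (simp add: dot_square_norm power2_eq_square field_simps)
  qed (use e in auto)
  then have "bounded {v \<in> normal_cone K y. v \<bullet> y = 1}" unfolding bounded_iff by blast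
  moreover have "{v \<in> normal_cone K y. v \<bullet> y = 1} = (\<Inter>x\<in>K. {v. v \<bullet> (x - y) \<le> 0}) \<inter> {v. v \<bullet> y = 1}"
    by (auto simp: normal_cone_def)
  moreover have "closed \<dots>"
    by (intro closed_Int closed_INT ballI closed_Collect_le closed_Collect_eq continuous_intros)
  ultimately show ?thesis by (simp add: compact_eq_bounded_closed)
qed

lemma not_translatable_imp_normals:
  fixes K :: "'a::euclidean_space set"
  assumes K: "convex_body K" and y: "\<And>i. i < m \<Longrightarrow> y i \<in> K" and nt: "\<not> translatable K y m"
  shows "\<exists>a. (\<forall>i<m. a i \<in> normal_cone K (y i)) \<and> (\<Sum>i<m. a i) = 0 \<and> (\<exists>i<m. a i \<noteq> 0)"
proof -
  have cK: "convex K" and K0: "0 \<in> interior K" using K by (auto simp: convex_body_def)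
  \<comment> \<open>Normals scaled by \<open>v \<bullet> y i = 1\<close> (possible as \<open>0\<close> is interior to \<open>K\<close>) form a compact set; a functional
    separating its convex hull from \<open>0\<close> would be a direction moving all vertices into the interior.\<close>
  define W where "W = (\<Union>i<m. {v \<in> normal_cone K (y i). v \<bullet> y i = 1})"
  have cW: "compact W" unfolding W_def by (intro compact_UN compact_normalized_normals[OF K]) auto
  have "0 \<in> convex hull W"
  proof (rule ccontr)
    assume "0 \<notin> convex hull W"
    then obtain u b where u: "0 < b" "\<And>x. x \<in> convex hull W \<Longrightarrow> u \<bullet> x > b"
      using separating_hyperplane_closed_0[of "convex hull W"] compact_convex_hull[OF cW]
      by (auto simp: compact_imp_closed convex_convex_hull)
    define t where "t = - u"
    have "\<exists>s>0. y i + s *\<^sub>R t \<in> interior K" if i: "i < m" for i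
    proof (rule enters_interior[OF K y[OF i]])
      fix v assume v: "v \<in> normal_cone K (y i)" "v \<noteq> 0"
      have pos: "v \<bullet> y i > 0" using normal_cone_interior_less[OF v K0] by simp
      have "(1 / (v \<bullet> y i)) *\<^sub>R v \<in> W"
        unfolding W_def using i pos v by (auto intro!: normal_cone_scaleR)
      then have "u \<bullet> ((1 / (v \<bullet> y i)) *\<^sub>R v) > 0"
        using u hull_inc by (metis less_trans)
      then have "u \<bullet> v > 0" using pos by (simp add: zero_less_divide_iff)
      then show "v \<bullet> t < 0" by (simp add: t_def inner_commute)
    qed
    then obtain s where s: "\<And>i. i < m \<Longrightarrow> s i > 0" "\<And>i. i < m \<Longrightarrow> y i + s i *\<^sub>R t \<in> interior K"
      by metis
    \<comment> \<open>One step length for all vertices: by convexity, a shorter step from a point of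
      \<open>K\<close> towards an interior point also ends in the interior.\<close>
    define s0 where "s0 = Min (insert 1 (s ` {..<m}))"
    have s0: "s0 > 0" using s(1) by (auto simp: s0_def)
    have "y i + s0 *\<^sub>R t \<in> interior K" if i: "i < m" for i
    proof -
      have le: "s0 \<le> s i" using i by (auto simp: s0_def)
      have "y i - (s0 / s i) *\<^sub>R (y i - (y i + s i *\<^sub>R t)) \<in> interior K"
        using s0 le s(1)[OF i] by (intro mem_interior_convex_shrink[OF cK s(2)[OF i] y[OF i]]) auto
      then show ?thesis using s(1)[OF i] by simp
    qed
    then show False using nt unfolding translatable_def by blast
  qed
  then obtain S c where S: "finite S" "S \<subseteq> W" "\<And>v. v \<in> S \<Longrightarrow> 0 \<le> c v" "sum c S = 1" "(\<Sum>v\<in>S. c v *\<^sub>R v) = 0"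
    by (auto simp: convex_hull_explicit)
  have "\<forall>v\<in>S. \<exists>i<m. v \<in> normal_cone K (y i) \<and> v \<bullet> y i = 1" using S(2) by (auto simp: W_def)
  then obtain f where f: "\<And>v. v \<in> S \<Longrightarrow> f v < m" "\<And>v. v \<in> S \<Longrightarrow> v \<in> normal_cone K (y (f v))"
      "\<And>v. v \<in> S \<Longrightarrow> v \<bullet> y (f v) = 1" by metis
  \<comment> \<open>The convex combination is grouped by the vertex to which each normal is
    assigned.\<close>
  define a where "a i = (\<Sum>v\<in>{v\<in>S. f v = i}. c v *\<^sub>R v)" for i
  have "a i \<in> normal_cone K (y i)" for i
    unfolding a_def using S f by (intro normal_cone_sum) (auto intro: normal_cone_scaleR)
  moreover have "(\<Sum>i<m. a i) = 0"
    unfolding a_def using S f by (subst sum.group) auto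
  moreover have "\<exists>i<m. a i \<noteq> 0"
  proof (rule ccontr)
    assume "\<not> ?thesis"
    then have "(\<Sum>i<m. a i \<bullet> y i) = 0" by simp
    \<comment> \<open>The normalization turns this sum into the total weight 1, so the grouped
      normals cannot all vanish.\<close>
    moreover have "(\<Sum>i<m. a i \<bullet> y i) = (\<Sum>i<m. \<Sum>v\<in>{v\<in>S. f v = i}. c v)"
      unfolding a_def inner_sum_left using f by (intro sum.cong) auto
    moreover have "\<dots> = 1" using S f by (subst sum.group) auto
    ultimately show False by simp
  qed
  ultimately show ?thesis by blast
qed

section \<open>First-order condition for the length\<close>

text \<open>If a subsequence of the maximizers stayed away from \<open>p\<close>, compactness would
  give it a limit point in \<open>T\<close>. That point also maximizes \<open>e\<close>, hence
  equals \<open>p\<close> by strict convexity.\<close>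

lemma maximizers_tendsto:
  fixes T :: "'a::euclidean_space set"
  assumes "compact T" "strictly_convex T" "e \<noteq> 0" and p: "p \<in> T" "e \<in> normal_cone T p"
    and x: "x \<longlonglongrightarrow> e" and P: "\<And>k. P k \<in> T" "\<And>k. x k \<in> normal_cone T (P k)"
  shows "P \<longlonglongrightarrow> p"
proof (rule ccontr)
  assume "\<not> P \<longlonglongrightarrow> p"
  then obtain r where r: "r > 0" "\<And>N. \<exists>n\<ge>N. r \<le> dist (P n) p"
    unfolding lim_sequentially by (auto simp: not_less)
  then have "infinite {n. r \<le> dist (P n) p}"
    unfolding infinite_nat_iff_unbounded_le by auto
  from infinite_enumerate[OF this]
  obtain \<sigma> :: "nat \<Rightarrow> nat" where \<sigma>: "strict_mono \<sigma>" "\<And>n. r \<le> dist (P (\<sigma> n)) p" by blast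
  obtain l \<tau> where l: "l \<in> T" "strict_mono \<tau>" "((P \<circ> \<sigma>) \<circ> \<tau>) \<longlonglongrightarrow> l"
    using assms(1)[unfolded compact_def, rule_format, of "P \<circ> \<sigma>"] P(1) by auto
  have sx: "(x \<circ> (\<sigma> \<circ> \<tau>)) \<longlonglongrightarrow> e" by (intro LIMSEQ_subseq_LIMSEQ[OF x] strict_mono_o \<sigma> l)
  have "e \<bullet> (y - l) \<le> 0" if "y \<in> T" for y
  proof (rule LIMSEQ_le_const2)
    show "(\<lambda>k. (x \<circ> (\<sigma> \<circ> \<tau>)) k \<bullet> (y - ((P \<circ> \<sigma>) \<circ> \<tau>) k)) \<longlonglongrightarrow> e \<bullet> (y - l)"
      by (intro tendsto_intros sx l(3))
    show "\<exists>N. \<forall>n\<ge>N. (x \<circ> (\<sigma> \<circ> \<tau>)) n \<bullet> (y - (P \<circ> \<sigma> \<circ> \<tau>) n) \<le> 0"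
      using P(2) that by (auto simp: normal_cone_def)
  qed
  then have "e \<in> normal_cone T l" by (simp add: normal_cone_def)
  then have "l = p" using strictly_convex_maximizer_unique[OF assms(2,3) l(1) p(1)] p(2) by blast
  moreover have "(\<lambda>n. dist (((P \<circ> \<sigma>) \<circ> \<tau>) n) p) \<longlonglongrightarrow> dist l p" by (intro tendsto_intros l(3))
  then have "r \<le> dist l p" using \<sigma>(2) by (intro LIMSEQ_le_const) auto
  ultimately show False using r(1) by simp
qed

text \<open>The Farkas lemma for a single inequality: the component of \<open>g\<close> orthogonal
  to \<open>a\<close> is shown to vanish by testing with its negative.\<close>

lemma linear_nonneg_on_halfspace_imp_multiple:
  fixes a g :: "nat \<Rightarrow> 'a::real_inner"
  assumes "\<And>d. (\<Sum>i<m. a i \<bullet> d i) \<ge> 0 \<Longrightarrow> (\<Sum>i<m. g i \<bullet> d i) \<ge> 0"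
  shows "\<exists>c\<ge>0. \<forall>i<m. g i = c *\<^sub>R a i"
proof -
  define A where "A = (\<Sum>i<m. a i \<bullet> a i)"
  \<comment> \<open>The coefficient of the orthogonal projection of \<open>g\<close> onto
    \<open>a\<close>; if all \<open>a i\<close> vanish, division by zero makes it 0.\<close>
  define c where "c = (\<Sum>i<m. g i \<bullet> a i) / A"
  have A0: "A \<ge> 0" unfolding A_def by (intro sum_nonneg) auto
  have ga: "(\<Sum>i<m. g i \<bullet> a i) \<ge> 0" using A0 by (intro assms) (simp add: A_def)
  then have c0: "c \<ge> 0" using A0 by (simp add: c_def)
  define d where "d i = g i - c *\<^sub>R a i" for i
  have ad: "(\<Sum>i<m. a i \<bullet> d i) = 0"
  proof (cases "A = 0")
    case True
    then have "\<forall>i<m. a i = 0" unfolding A_def by (subst (asm) sum_nonneg_eq_0_iff) auto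
    then show ?thesis by simp
  next
    case False
    have "(\<Sum>i<m. a i \<bullet> d i) = (\<Sum>i<m. a i \<bullet> g i) - c * A"
      by (simp add: d_def inner_diff_right sum_subtractf sum_distrib_left A_def)
    then show ?thesis using False by (simp add: c_def inner_commute)
  qed
  have "(\<Sum>i<m. g i \<bullet> (- d i)) \<ge> 0" by (rule assms) (simp add: ad sum_negf)
  then have "(\<Sum>i<m. g i \<bullet> d i) \<le> 0" by (simp add: sum_negf)
  moreover have "(\<Sum>i<m. d i \<bullet> d i) = (\<Sum>i<m. g i \<bullet> d i) - c * (\<Sum>i<m. a i \<bullet> d i)"
    by (simp add: d_def inner_diff_left sum_subtractf flip: sum_distrib_left)
  ultimately have "(\<Sum>i<m. d i \<bullet> d i) = 0" using ad sum_nonneg[of "{..<m}" "\<lambda>i. d i \<bullet> d i"] by simp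
  then have "\<forall>i<m. d i = 0" by (subst (asm) sum_nonneg_eq_0_iff) auto
  then show ?thesis using c0 by (auto simp: d_def)
qed

text \<open>A Lagrange multiplier rule: displacing vertex \<open>i\<close> by \<open>d i\<close>
  changes the length at the rate \<open>(p (pred i) - p i) \<bullet> d i\<close>, where
  \<open>pred i\<close> is the cyclic predecessor. The sum of these rates is nonnegative on the
  half-space given by \<open>a\<close>.\<close>

lemma first_order_condition:
  fixes T :: "'a::euclidean_space set"
  assumes T: "convex_body T" "strictly_convex T"
    and ne: "\<And>j. j < m \<Longrightarrow> y (Suc j mod m) \<noteq> y j"
    and p: "\<And>j. j < m \<Longrightarrow> p j \<in> T" "\<And>j. j < m \<Longrightarrow> y (Suc j mod m) - y j \<in> normal_cone T (p j)"
    and min: "\<And>d. (\<Sum>i<m. a i \<bullet> d i) \<ge> 0 \<Longrightarrow> lengthT T y m \<le> lengthT T (\<lambda>i. y i + d i) m"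
  shows "\<exists>c\<ge>0. \<forall>j<m. p j - p (Suc j mod m) = c *\<^sub>R a (Suc j mod m)"
proof -
  have cT: "compact T" using T by (auto simp: convex_body_def)
  \<comment> \<open>Directional derivatives: the maximizers \<open>P k j\<close> for the perturbed edges bound the difference
    quotient of the length from above, and tend to \<open>p j\<close>.\<close>
  define pred where "pred i = (i + m - 1) mod m" for i
  have pred: "pred (Suc j mod m) = j" if "j < m" for j
    using that by (cases "Suc j = m") (auto simp: pred_def)
  have "(\<Sum>i<m. (p (pred i) - p i) \<bullet> d i) \<ge> 0" if d: "(\<Sum>i<m. a i \<bullet> d i) \<ge> 0" for d
  proof -
    define e where "e j = y (Suc j mod m) - y j" for j
    define f where "f j = d (Suc j mod m) - d j" for j
    define s where "s k = 1 / real (Suc k)" for k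
    have s: "s k > 0" for k by (simp add: s_def)
    have s_lim: "s \<longlonglongrightarrow> 0" unfolding s_def[abs_def] using LIMSEQ_Suc[OF lim_1_over_n] by simp
    have "\<forall>k j. \<exists>P. P \<in> T \<and> e j + s k *\<^sub>R f j \<in> normal_cone T P"
      using gauge_polar_attained[OF T(1)] normal_cone_iff_gauge_polar[OF T(1)] by metis
    then obtain P where P: "\<And>k j. P k j \<in> T" "\<And>k j. e j + s k *\<^sub>R f j \<in> normal_cone T (P k j)" by metis
    have P_lim: "(\<lambda>k. P k j) \<longlonglongrightarrow> p j" if "j < m" for j
    proof (rule maximizers_tendsto[OF cT T(2)])
      show "e j \<noteq> 0" "p j \<in> T" "e j \<in> normal_cone T (p j)" using ne p that by (auto simp: e_def)
      have "(\<lambda>k. e j + s k *\<^sub>R f j) \<longlonglongrightarrow> e j + 0 *\<^sub>R f j" by (intro tendsto_intros s_lim)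
      then show "(\<lambda>k. e j + s k *\<^sub>R f j) \<longlonglongrightarrow> e j" by simp
    qed (use P in auto)
    have "(\<Sum>j<m. f j \<bullet> P k j) \<ge> 0" for k
    proof -
      have "(\<Sum>i<m. a i \<bullet> (s k *\<^sub>R d i)) = s k * (\<Sum>i<m. a i \<bullet> d i)" by (simp add: sum_distrib_left)
      then have "lengthT T y m \<le> lengthT T (\<lambda>i. y i + s k *\<^sub>R d i) m"
        using d s[of k] by (intro min) (simp add: less_imp_le)
      also have "\<dots> = (\<Sum>j<m. (e j + s k *\<^sub>R f j) \<bullet> P k j)"
        unfolding lengthT_def
      proof (intro sum.cong refl)
        fix j
        have "y (Suc j mod m) + s k *\<^sub>R d (Suc j mod m) - (y j + s k *\<^sub>R d j) = e j + s k *\<^sub>R f j"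
          by (simp add: e_def f_def algebra_simps)
        then show "gauge (polar T) (y (Suc j mod m) + s k *\<^sub>R d (Suc j mod m) - (y j + s k *\<^sub>R d j))
            = (e j + s k *\<^sub>R f j) \<bullet> P k j"
          using P normal_cone_iff_gauge_polar[OF T(1)] by metis
      qed
      also have "\<dots> \<le> (\<Sum>j<m. gauge (polar T) (e j) + s k * (f j \<bullet> P k j))"
        using inner_le_gauge_polar[OF T(1) P(1)] by (intro sum_mono) (simp add: inner_add_left)
      also have "\<dots> = lengthT T y m + s k * (\<Sum>j<m. f j \<bullet> P k j)"
        by (simp add: sum.distrib sum_distrib_left lengthT_def e_def)
      finally show ?thesis using s[of k] by (simp add: zero_le_mult_iff)
    qed
    moreover have "(\<lambda>k. \<Sum>j<m. f j \<bullet> P k j) \<longlonglongrightarrow> (\<Sum>j<m. f j \<bullet> p j)"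
      by (intro tendsto_intros P_lim) auto
    ultimately have "(\<Sum>j<m. f j \<bullet> p j) \<ge> 0" by (intro LIMSEQ_le_const) auto
    \<comment> \<open>Summation by parts passes from the displacements of edges to those of
      vertices.\<close>
    moreover have "(\<Sum>j<m. p j \<bullet> d (Suc j mod m)) = (\<Sum>i<m. p (pred i) \<bullet> d i)"
      using sum_cyclic_shift[of "\<lambda>i. p (pred i) \<bullet> d i" m] pred by simp
    ultimately show ?thesis
      by (simp add: f_def inner_diff_left inner_diff_right sum_subtractf inner_commute)
  qed
  from linear_nonneg_on_halfspace_imp_multiple[OF this]
  obtain c where c: "c \<ge> 0" "\<And>i. i < m \<Longrightarrow> p (pred i) - p i = c *\<^sub>R a i" by blast
  have "p j - p (Suc j mod m) = c *\<^sub>R a (Suc j mod m)" if "j < m" for j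
    using c(2)[of "Suc j mod m"] pred[OF that] that by simp
  then show ?thesis using c(1) by blast
qed

section \<open>Shortest non-translatable polygons are billiard trajectories\<close>

lemma drop_vertex:
  fixes K T :: "'a::euclidean_space set"
  assumes T: "convex_body T" and m: "m \<ge> 2" and i: "i < m"
  shows "\<exists>z. lengthT T z (m - 1) \<le> lengthT T y m \<and>
    (translatable K z (m - 1) \<longrightarrow> (\<exists>t. \<forall>j<m. j \<noteq> i \<longrightarrow> y j + t \<in> interior K))"
proof -
  \<comment> \<open>The rotation puts vertex \<open>i\<close> at position \<open>m - 1\<close>, the
    one that is dropped.\<close>
  define z where "z k = y ((k + Suc i) mod m)" for k
  obtain n where n: "m = Suc (Suc n)" using m by (metis add_2_eq_Suc le_Suc_ex)
  have "lengthT T z (m - 1) \<le> lengthT T z m" using lengthT_drop_last[OF T, of z n] by (simp add: n)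
  also have "\<dots> = lengthT T y m" unfolding z_def by (rule lengthT_rotate)
  finally have 1: "lengthT T z (m - 1) \<le> lengthT T y m" .
  have "\<exists>k<m - 1. y j = z k" if j: "j < m" "j \<noteq> i" for j
  proof (cases "i < j")
    case True
    then have "(j - i - 1 + Suc i) mod m = j" using j by simp
    then show ?thesis using True j by (intro exI[of _ "j - i - 1"]) (auto simp: z_def)
  next
    case False
    then have "j + m - i - 1 + Suc i = j + m" using i by simp
    then have "(j + m - i - 1 + Suc i) mod m = j" using j by simp
    then show ?thesis using False j i by (intro exI[of _ "j + m - i - 1"]) (auto simp: z_def)
  qed
  then have "translatable K z (m - 1) \<longrightarrow> (\<exists>t. \<forall>j<m. j \<noteq> i \<longrightarrow> y j + t \<in> interior K)"
    unfolding translatable_def by metis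
  then show ?thesis using 1 by blast
qed

text \<open>By \<open>fewer\<close> every vertex is essential: the others can be translated into the
  interior. Hence no vertex lies between its neighbours and all normals are nonzero. The first-order
  condition turns the maximizers on the edges into the dual polygon.\<close>

lemma shortest_not_translatable_billiard:
  fixes K T :: "'a::euclidean_space set"
  assumes K: "convex_body K" and T: "convex_body T" "strictly_convex T"
    and nt: "\<not> translatable K y m"
    and shortest: "\<And>z. \<not> translatable K z m \<Longrightarrow> lengthT T y m \<le> lengthT T z m"
    and fewer: "\<And>z m'. m' < m \<Longrightarrow> lengthT T z m' \<le> lengthT T y m \<Longrightarrow> translatable K z m'"
  shows "\<exists>q. minkowski_billiard K T q m \<and> lengthT T q m = lengthT T y m"
proof -
  have K0: "0 \<in> interior K" and cK: "convex K" using K by (auto simp: convex_body_def)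
  have m: "m \<ge> 2"
  proof (rule ccontr)
    assume "\<not> m \<ge> 2"
    then have "i = 0" if "i < m" for i using that by simp
    then have "\<forall>i<m. y i + (- y 0) \<in> interior K" using K0 by (metis add.right_inverse)
    then show False using nt unfolding translatable_def by blast
  qed
  have ess: "\<exists>t. \<forall>j<m. j \<noteq> i \<longrightarrow> y j + t \<in> interior K" if "i < m" for i
    using drop_vertex[OF T(1) m that, of y K] fewer[of "m - 1"] m by auto
  \<comment> \<open>A polygon of length 0 is a single point, which can be translated to 0.\<close>
  have lpos: "lengthT T y m > 0"
  proof (rule ccontr)
    assume "\<not> ?thesis"
    moreover obtain r where r: "r > 0" "\<And>x. r * norm x \<le> gauge (polar T) x"
      using gauge_polar_ge_norm[OF T(1)] by blast
    ultimately have "lengthT T y m / r \<le> 0" by (simp add: divide_nonpos_pos)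
    have "y i + (- y 0) = 0" if "i < m" for i
    proof -
      have "norm (y i - y 0) \<le> 0"
        using norm_diff_le_lengthT[OF T(1) r that, of y] \<open>lengthT T y m / r \<le> 0\<close> by linarith
      then show ?thesis by simp
    qed
    then have "\<forall>i<m. y i + (- y 0) \<in> interior K" using K0 by metis
    then show False using nt unfolding translatable_def by blast
  qed
  \<comment> \<open>Shrinking makes the polygon strictly shorter than the shortest non-translatable
    one.\<close>
  have "translatable K (\<lambda>i. c *\<^sub>R y i) m" if "0 < c" "c < 1" for c
  proof (rule ccontr)
    assume "\<not> ?thesis"
    from shortest[OF this] have "lengthT T y m \<le> c * lengthT T y m"
      using lengthT_scaleR[OF T(1), of c y m] that by simp
    then show False using lpos that by (simp add: mult_le_cancel_right1)
  qed
  then obtain s where s: "\<And>i. i < m \<Longrightarrow> y i + s \<in> K" using translates_into_body[OF K] by blast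
  define q where "q i = y i + s" for i
  have qK: "q i \<in> K" if "i < m" for i using s that by (simp add: q_def)
  have qlen: "lengthT T q m = lengthT T y m" unfolding q_def[abs_def] by (rule lengthT_translate)
  have qnt: "\<not> translatable K q m" using nt by (simp add: q_def[abs_def] translatable_translate)
  have qess: "\<exists>t. \<forall>j<m. j \<noteq> i \<longrightarrow> q j + t \<in> interior K" if i: "i < m" for i
  proof -
    obtain t where "\<forall>j<m. j \<noteq> i \<longrightarrow> y j + t \<in> interior K" using ess[OF i] by blast
    then show ?thesis by (intro exI[of _ "t - s"]) (simp add: q_def)
  qed
  have succ: "Suc j mod m < m" "Suc j mod m \<noteq> j" if "j < m" for j
    using that m by (cases "Suc j = m"; simp)+
  have pred: "(j + m - 1) mod m < m" "(j + m - 1) mod m \<noteq> j" if "j < m" for j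
    using that m by (cases j; simp)+
  \<comment> \<open>Otherwise a translation moving the other vertices into the interior would, by
    convexity, take this vertex along.\<close>
  have ind: "q j \<notin> closed_segment (q ((j + m - 1) mod m)) (q (Suc j mod m))" if j: "j < m" for j
  proof
    assume seg: "q j \<in> closed_segment (q ((j + m - 1) mod m)) (q (Suc j mod m))"
    obtain t where t: "\<And>i. i < m \<Longrightarrow> i \<noteq> j \<Longrightarrow> q i + t \<in> interior K" using qess[OF j] by blast
    have "t + q j \<in> closed_segment (t + q ((j + m - 1) mod m)) (t + q (Suc j mod m))"
      using seg by (simp add: closed_segment_translation)
    also have "\<dots> \<subseteq> interior K"
      using t succ[OF j] pred[OF j]
      by (intro closed_segment_subset convex_interior cK) (auto simp: add.commute)
    finally have "\<forall>i<m. q i + t \<in> interior K" using t by (metis add.commute)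
    then show False using qnt unfolding translatable_def by blast
  qed
  have ne: "q (Suc j mod m) \<noteq> q j" if "j < m" for j
    using ind[OF that] by (metis ends_in_segment(2))
  obtain a where a: "\<And>i. i < m \<Longrightarrow> a i \<in> normal_cone K (q i)" "(\<Sum>i<m. a i) = 0" "\<exists>i<m. a i \<noteq> 0"
    using not_translatable_imp_normals[OF K qK qnt] by blast
  have a_nz: "a i \<noteq> 0" if i: "i < m" for i
  proof
    assume "a i = 0"
    obtain t where t: "\<And>j. j < m \<Longrightarrow> j \<noteq> i \<Longrightarrow> q j + t \<in> interior K" using qess[OF i] by blast
    \<comment> \<open>Since \<open>a i = 0\<close>, vertex \<open>i\<close> can be moved freely;
      this displacement sends it to 0 after the translation by \<open>t\<close>.\<close>
    define d where "d j = (if j = i then - t - q i else 0)" for j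
    have "(\<Sum>j<m. a j \<bullet> d j) = 0" using \<open>a i = 0\<close> by (intro sum.neutral) (auto simp: d_def)
    then have "\<not> translatable K (\<lambda>j. q j + d j) m" by (intro normals_imp_not_translatable[OF a]) auto
    moreover have "\<forall>j<m. q j + d j + t \<in> interior K" using t K0 by (auto simp: d_def)
    ultimately show False unfolding translatable_def by blast
  qed
  have "\<forall>j. \<exists>p. p \<in> T \<and> q (Suc j mod m) - q j \<in> normal_cone T p"
    using gauge_polar_attained[OF T(1)] normal_cone_iff_gauge_polar[OF T(1)] by metis
  then obtain p where p: "\<And>j. p j \<in> T" "\<And>j. q (Suc j mod m) - q j \<in> normal_cone T (p j)" by metis
  have "\<exists>c\<ge>0. \<forall>j<m. p j - p (Suc j mod m) = c *\<^sub>R a (Suc j mod m)"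
  proof (rule first_order_condition[where y = q and p = p and a = a, OF T ne])
    fix d assume "(\<Sum>i<m. a i \<bullet> d i) \<ge> 0"
    then have "\<not> translatable K (\<lambda>i. q i + d i) m" by (intro normals_imp_not_translatable[where a = a and y = q and d = d, OF a])
    then show "lengthT T q m \<le> lengthT T (\<lambda>i. q i + d i) m" using shortest qlen by simp
  qed (use p in auto)
  then obtain c where c: "c \<ge> 0" "\<And>j. j < m \<Longrightarrow> p j - p (Suc j mod m) = c *\<^sub>R a (Suc j mod m)" by blast
  have "billiard_dual K T q m p"
    unfolding billiard_dual_def
  proof (intro allI impI conjI)
    fix j assume j: "j < m"
    show "p j \<in> frontier T" using normal_cone_frontier[OF p(2) _ p(1)] ne[OF j] by auto
    show "q (Suc j mod m) - q j \<in> normal_cone T (p j)" by (rule p)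
    have "p (Suc j mod m) - p j = - (c *\<^sub>R a (Suc j mod m))" using c(2)[OF j] by (metis minus_diff_eq)
    then show "p (Suc j mod m) - p j \<in> uminus ` normal_cone K (q (Suc j mod m))"
      using normal_cone_scaleR[OF a(1)[OF succ(1)[OF j]] c(1)] by blast
  qed
  moreover have "closed_polygonal q m" using m ind ne unfolding closed_polygonal_def by metis
  moreover have "\<forall>j<m. q j \<in> frontier K" using normal_cone_frontier a(1) a_nz qK by blast
  ultimately show ?thesis using qlen unfolding minkowski_billiard_def by blast
qed

text \<open>Among the non-translatable polygons shorter than \<open>q\<close>, one with the fewest
  vertices, and shortest for that number, would be a billiard trajectory shorter than
  \<open>q\<close>.\<close>

lemma lT_minimizing_le_not_translatable:
  fixes K T :: "'a::euclidean_space set"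
  assumes K: "convex_body K" and T: "convex_body T" "strictly_convex T"
    and q: "lT_minimizing K T q m" and nt: "\<not> translatable K y k"
  shows "lengthT T q m \<le> lengthT T y k"
proof (rule ccontr)
  assume short: "\<not> ?thesis"
  define P where "P k \<longleftrightarrow> (\<exists>z. \<not> translatable K z k \<and> lengthT T z k < lengthT T q m)" for k
  have "P k" using nt short by (auto simp: P_def)
  define k0 where "k0 = (LEAST k. P k)"
  have "P k0" unfolding k0_def by (rule LeastI[of P, OF \<open>P k\<close>])
  then obtain z where z: "\<not> translatable K z k0" "lengthT T z k0 < lengthT T q m" by (auto simp: P_def)
  obtain x where x: "\<not> translatable K x k0" "\<And>z. \<not> translatable K z k0 \<Longrightarrow> lengthT T x k0 \<le> lengthT T z k0"
    using shortest_not_translatable_exists[OF T(1) z(1)] by blast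
  have less: "lengthT T x k0 < lengthT T q m" using x(2)[OF z(1)] z(2) by simp
  have "\<exists>q'. minkowski_billiard K T q' k0 \<and> lengthT T q' k0 = lengthT T x k0"
  proof (rule shortest_not_translatable_billiard[OF K T x])
    fix w k' assume "k' < k0" "lengthT T w k' \<le> lengthT T x k0"
    then have "\<not> P k'" "lengthT T w k' < lengthT T q m" using less not_less_Least by (auto simp: k0_def)
    then show "translatable K w k'" by (auto simp: P_def)
  qed
  then show False using q less unfolding lT_minimizing_def by fastforce
qed

section \<open>Linear relations between the normals\<close>

text \<open>With \<open>mu\<close> as the coefficients of a positive relation, coefficients can be
  made nonnegative without changing the combination.\<close>

lemma add_multiple_nonneg:
  fixes mu c :: "nat \<Rightarrow> real"
  assumes "\<And>i. i < m \<Longrightarrow> mu i > 0"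
  shows "\<exists>M. \<forall>i<m. c i + M * mu i \<ge> 0"
proof -
  define M where "M = Max (insert 0 ((\<lambda>i. - c i / mu i) ` {..<m}))"
  have "c i + M * mu i \<ge> 0" if "i < m" for i
  proof -
    have "- c i / mu i \<le> M" unfolding M_def using that by (intro Max_ge) auto
    then show ?thesis using assms[OF that] by (simp add: field_simps)
  qed
  then show ?thesis by blast
qed

lemma sum_scaleR_add_relation:
  fixes n :: "nat \<Rightarrow> 'a::real_vector"
  assumes "(\<Sum>i<m. mu i *\<^sub>R n i) = 0"
  shows "(\<Sum>i<m. (c i + M * mu i) *\<^sub>R n i) = (\<Sum>i<m. c i *\<^sub>R n i)"
proof -
  have "(\<Sum>i<m. (c i + M * mu i) *\<^sub>R n i) = (\<Sum>i<m. c i *\<^sub>R n i) + M *\<^sub>R (\<Sum>i<m. mu i *\<^sub>R n i)"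
    by (simp add: scaleR_add_left sum.distrib scaleR_sum_right)
  then show ?thesis using assms by simp
qed

text \<open>Adding a large multiple of the positive relation makes the coefficients of any linear
  combination nonnegative.\<close>

lemma cone_spanned_eq_span:
  fixes n :: "nat \<Rightarrow> 'a::euclidean_space"
  assumes "\<And>i. i < m \<Longrightarrow> mu i > 0" "(\<Sum>i<m. mu i *\<^sub>R n i) = 0"
  shows "cone_spanned n m = span (n ` {..<m})"
proof
  show "cone_spanned n m \<subseteq> span (n ` {..<m})"
    unfolding cone_spanned_def by (clarify, intro span_sum span_scale span_base) auto
  \<comment> \<open>The combinations are indexed by \<open>i\<close> because \<open>n\<close> may
    repeat vectors.\<close>
  have "subspace {\<Sum>i<m. c i *\<^sub>R n i | c. True}"
    unfolding subspace_def
  proof (intro conjI ballI allI)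
    show "0 \<in> {\<Sum>i<m. c i *\<^sub>R n i | c. True}" by (auto intro!: exI[of _ "\<lambda>_. 0"])
  next
    fix x y assume "x \<in> {\<Sum>i<m. c i *\<^sub>R n i | c. True}" "y \<in> {\<Sum>i<m. c i *\<^sub>R n i | c. True}"
    then obtain c d where "x = (\<Sum>i<m. c i *\<^sub>R n i)" "y = (\<Sum>i<m. d i *\<^sub>R n i)" by blast
    then have "x + y = (\<Sum>i<m. (c i + d i) *\<^sub>R n i)" by (simp add: scaleR_add_left sum.distrib)
    then show "x + y \<in> {\<Sum>i<m. c i *\<^sub>R n i | c. True}"
      by (intro CollectI exI[of _ "\<lambda>i. c i + d i"]) simp
  next
    fix r x assume "x \<in> {\<Sum>i<m. c i *\<^sub>R n i | c. True}"
    then obtain c where "x = (\<Sum>i<m. c i *\<^sub>R n i)" by blast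
    then have "r *\<^sub>R x = (\<Sum>i<m. (r * c i) *\<^sub>R n i)" by (simp add: scaleR_sum_right)
    then show "r *\<^sub>R x \<in> {\<Sum>i<m. c i *\<^sub>R n i | c. True}"
      by (intro CollectI exI[of _ "\<lambda>i. r * c i"]) simp
  qed
  moreover have "n ` {..<m} \<subseteq> {\<Sum>i<m. c i *\<^sub>R n i | c. True}"
  proof (rule image_subsetI)
    fix j assume "j \<in> {..<m}"
    then have "(\<Sum>i<m. (if i = j then 1 else 0) *\<^sub>R n i) = n j"
      by (simp add: if_distrib[of "\<lambda>c. c *\<^sub>R _"] cong: if_cong)
    then show "n j \<in> {\<Sum>i<m. c i *\<^sub>R n i | c. True}"
      by (intro CollectI exI[of _ "\<lambda>i. if i = j then 1 else 0"]) simp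
  qed
  ultimately have "span (n ` {..<m}) \<subseteq> {\<Sum>i<m. c i *\<^sub>R n i | c. True}" by (simp add: span_minimal)
  also have "\<dots> \<subseteq> cone_spanned n m"
  proof clarify
    fix c :: "nat \<Rightarrow> real"
    obtain M where "\<forall>i<m. c i + M * mu i \<ge> 0" using add_multiple_nonneg[of m mu c] assms(1) by blast
    then show "(\<Sum>i<m. c i *\<^sub>R n i) \<in> cone_spanned n m"
      unfolding cone_spanned_def
      by (intro CollectI exI[of _ "\<lambda>i. c i + M * mu i"]) (simp add: sum_scaleR_add_relation[OF assms(2)])
  qed
  finally show "span (n ` {..<m}) \<subseteq> cone_spanned n m" .
qed

text \<open>A relation among all vectors but the last has coefficient 0 at the last, hence is the
  zero multiple of \<open>mu\<close>. So these vectors are independent, and the relation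
  \<open>mu\<close> expresses the last one through them.\<close>

lemma dim_span_one_relation:
  fixes n :: "nat \<Rightarrow> 'a::euclidean_space"
  assumes m: "m \<ge> 1" and mu: "\<And>i. i < m \<Longrightarrow> mu i > 0" "(\<Sum>i<m. mu i *\<^sub>R n i) = 0"
    and rel: "\<And>c. (\<Sum>i<m. c i *\<^sub>R n i) = 0 \<Longrightarrow> \<exists>r. \<forall>i<m. c i = r * mu i"
  shows "dim (span (n ` {..<m})) = m - 1"
proof -
  obtain k where k: "m = Suc k" using m by (cases m) auto
  have rel0: "c i = 0" if "(\<Sum>i<k. c i *\<^sub>R n i) = 0" "i < k" for c i
  proof -
    define c' where "c' i = (if i < k then c i else 0)" for i
    have "(\<Sum>i<m. c' i *\<^sub>R n i) = 0" using that(1) by (simp add: k c'_def)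
    from rel[OF this] obtain r where r: "\<And>i. i < m \<Longrightarrow> c' i = r * mu i" by blast
    have "r = 0" using r[of k] mu(1)[of k] k by (simp add: c'_def)
    then show ?thesis using r[of i] that k by (simp add: c'_def)
  qed
  \<comment> \<open>Two equal vectors would satisfy a relation with coefficients 1 and -1.
    Injectivity allows independence of the image set to be read off the indexed relations.\<close>
  have inj: "inj_on n {..<k}"
  proof (rule inj_onI, rule ccontr)
    fix i j assume ij: "i \<in> {..<k}" "j \<in> {..<k}" "n i = n j" "i \<noteq> j"
    define c where "c l = (if l = i then 1 else if l = j then -1 else 0 :: real)" for l
    have "(\<Sum>l<k. c l *\<^sub>R n l) = (\<Sum>l\<in>{i, j}. c l *\<^sub>R n l)"
      using ij by (intro sum.mono_neutral_right) (auto simp: c_def)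
    also have "\<dots> = 0" using ij by (simp add: c_def)
    finally show False using rel0[of c i] ij by (simp add: c_def)
  qed
  have ind: "independent (n ` {..<k})"
    unfolding independent_explicit_finite_subsets
  proof (intro allI impI ballI)
    fix S u v assume S: "S \<subseteq> n ` {..<k}" "finite S" "(\<Sum>v\<in>S. u v *\<^sub>R v) = 0" "v \<in> S"
    define c where "c i = (if n i \<in> S then u (n i) else 0)" for i
    have "(\<Sum>i<k. c i *\<^sub>R n i) = (\<Sum>v\<in>n ` {..<k}. (if v \<in> S then u v else 0) *\<^sub>R v)"
      by (simp add: sum.reindex[OF inj] c_def)
    also have "\<dots> = (\<Sum>v\<in>S. u v *\<^sub>R v)"
      using S(1) by (intro sum.mono_neutral_cong_right) auto
    finally have "(\<Sum>i<k. c i *\<^sub>R n i) = 0" using S by simp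
    moreover obtain i where "i < k" "v = n i" using S by auto
    ultimately show "u v = 0" using rel0[of c i] S(4) by (simp add: c_def)
  qed
  have "mu k *\<^sub>R n k = - (\<Sum>i<k. mu i *\<^sub>R n i)" using mu(2) by (simp add: k eq_neg_iff_add_eq_0 add.commute)
  moreover have "n k = (1 / mu k) *\<^sub>R (mu k *\<^sub>R n k)" using mu(1)[of k] k by simp
  ultimately have "n k = (1 / mu k) *\<^sub>R (- (\<Sum>i<k. mu i *\<^sub>R n i))" by simp
  also have "\<dots> \<in> span (n ` {..<k})"
    by (intro span_neg span_scale span_sum) (auto intro: span_base)
  finally have "n k \<in> span (n ` {..<k})" .
  then have "span (n ` {..<m}) = span (n ` {..<k})"
    by (simp add: k lessThan_Suc span_redundant)
  then have "dim (span (n ` {..<m})) = card (n ` {..<k})"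
    using dim_eq_card_independent[OF ind] by simp
  also have "\<dots> = m - 1" using inj by (simp add: card_image k)
  finally show ?thesis .
qed

section \<open>Uniqueness of the relation between the normals of a minimizing trajectory\<close>

theorem theorem1p3:
  fixes K T :: "'a::euclidean_space set"
    and q p nK :: "nat \<Rightarrow> 'a" and H :: "nat \<Rightarrow> 'a set" and mu :: "nat \<Rightarrow> real" and m :: nat
  assumes "convex_body K" and "convex_body T"
    and "strictly_convex T" and "smooth_body T"
    and "lT_minimizing K T q m"
    and "reflection_rule K T q m H p nK mu"
  shows "subspace (cone_spanned nK m) \<and> dim (cone_spanned nK m) = m - 1 \<and> m \<le> DIM('a) + 1 \<and>
         (\<forall>j<m. dim (normal_cone K (q j) \<inter> cone_spanned nK m) = 1)"
proof -
  note K = assms(1) and T = assms(2,3)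
  have poly: "closed_polygonal q m" using assms(5) by (auto simp: lT_minimizing_def minkowski_billiard_def)
  then have m: "m \<ge> 2" by (auto simp: closed_polygonal_def)
  have ne: "q (Suc j mod m) \<noteq> q j" if "j < m" for j
    using poly that unfolding closed_polygonal_def by metis
  have bd: "p j \<in> frontier T" "q (Suc j mod m) - q j \<in> normal_cone T (p j)" if "j < m" for j
    using assms(6) that by (auto simp: reflection_rule_def billiard_dual_def)
  have pT: "p j \<in> T" if "j < m" for j
    using bd(1)[OF that] T(1) compact_imp_closed frontier_subset_closed by (auto simp: convex_body_def)
  have n: "nK j \<in> normal_cone K (q j)" "norm (nK j) = 1" "mu j \<ge> 0" if "j < m" for j
    using assms(6) that by (auto simp: reflection_rule_def)
  then have n0: "nK j \<noteq> 0" if "j < m" for j using that by fastforce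
  have pd: "p j - p (Suc j mod m) = mu (Suc j mod m) *\<^sub>R nK (Suc j mod m)" if "j < m" for j
    using assms(6) that unfolding reflection_rule_def by (metis minus_diff_eq minus_minus)
  have succ: "Suc j mod m < m" for j using m by simp
  \<comment> \<open>If \<open>mu\<close> vanished at a vertex, both edges there would be normals at
    the same point of \<open>T\<close>. By smoothness they would have the same direction, placing
    the vertex on the segment between its neighbours.\<close>
  have mu_pos: "mu i > 0" if "i < m" for i
  proof -
    have "mu (Suc j mod m) \<noteq> 0" if j: "j < m" for j
    proof
      assume z: "mu (Suc j mod m) = 0"
      let ?i = "Suc j mod m"
      have pp: "p ?i = p j" using pd[OF j] z by simp
      obtain c where c: "c > 0" "q (Suc ?i mod m) - q ?i = c *\<^sub>R (q ?i - q j)"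
        using smooth_normal_cone_ray[OF T(1) assms(4) bd(1)[OF j] bd(2)[OF j], of "q (Suc ?i mod m) - q ?i"]
          bd(2)[OF succ, of j] ne[OF j] ne[OF succ, of j] pp by auto
      have pr: "(?i + m - 1) mod m = j" using j by (cases "Suc j = m") auto
      have "(1 + c) *\<^sub>R q ?i = c *\<^sub>R q j + q (Suc ?i mod m)"
        using c(2) by (simp add: algebra_simps)
      then have "q ?i = (1 / (1 + c)) *\<^sub>R (c *\<^sub>R q j + q (Suc ?i mod m))"
        using c(1) by (metis add_pos_pos less_irrefl nonzero_divide_eq_eq scaleR_one scaleR_scaleR zero_less_one)
      also have "\<dots> = (1 - 1 / (1 + c)) *\<^sub>R q j + (1 / (1 + c)) *\<^sub>R q (Suc ?i mod m)"
        using c(1) by (simp add: scaleR_add_right field_simps)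
      finally have "q ?i \<in> closed_segment (q j) (q (Suc ?i mod m))"
        using c(1) unfolding in_segment by (intro exI[of _ "1 / (1 + c)"]) auto
      then show False using poly succ[of j] pr unfolding closed_polygonal_def by metis
    qed
    then have "mu i \<noteq> 0" using all_cyclic_succ[of m "\<lambda>i. mu i \<noteq> 0"] that by blast
    then show ?thesis using n(3)[OF that] by simp
  qed
  have mu_rel: "(\<Sum>i<m. mu i *\<^sub>R nK i) = 0"
  proof -
    have "(\<Sum>i<m. mu i *\<^sub>R nK i) = (\<Sum>j<m. p j - p (Suc j mod m))"
      using sum_cyclic_shift[of "\<lambda>i. mu i *\<^sub>R nK i" m] pd by simp
    also have "\<dots> = 0" using sum_cyclic_shift[of p m] by (simp add: sum_subtractf)
    finally show ?thesis .
  qed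
  \<comment> \<open>Normals summing to zero keep every admissible perturbation of \<open>q\<close>
    non-translatable, hence no shorter than \<open>q\<close>. So the first-order condition holds
    with these \<open>a\<close>.\<close>
  have key: "\<exists>c>0. \<forall>i<m. mu i *\<^sub>R nK i = c *\<^sub>R a i"
    if a: "\<And>i. i < m \<Longrightarrow> a i \<in> normal_cone K (q i)" "(\<Sum>i<m. a i) = 0" "\<exists>i<m. a i \<noteq> 0" for a
  proof -
    have "\<exists>c\<ge>0. \<forall>j<m. p j - p (Suc j mod m) = c *\<^sub>R a (Suc j mod m)"
    proof (rule first_order_condition[where y = q and p = p and a = a, OF T ne pT bd(2)])
      fix d assume "(\<Sum>i<m. a i \<bullet> d i) \<ge> 0"
      then have "\<not> translatable K (\<lambda>i. q i + d i) m" by (intro normals_imp_not_translatable[where a = a and y = q and d = d, OF a])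
      then show "lengthT T q m \<le> lengthT T (\<lambda>i. q i + d i) m"
        by (rule lT_minimizing_le_not_translatable[OF K T assms(5)])
    qed
    then obtain c where c: "c \<ge> 0" "\<And>j. j < m \<Longrightarrow> p j - p (Suc j mod m) = c *\<^sub>R a (Suc j mod m)" by blast
    have eq: "mu i *\<^sub>R nK i = c *\<^sub>R a i" if "i < m" for i
    proof (rule all_cyclic_succ[of m "\<lambda>i. mu i *\<^sub>R nK i = c *\<^sub>R a i", OF _ that])
      fix j assume "j < m"
      then show "mu (Suc j mod m) *\<^sub>R nK (Suc j mod m) = c *\<^sub>R a (Suc j mod m)" using c(2) pd by simp
    qed
    have "c \<noteq> 0" using eq[of 0] mu_pos[of 0] n0[of 0] m by auto
    then show ?thesis using eq c(1) by (intro exI[of _ c]) auto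
  qed
  have nonneg_rel: "\<exists>r. \<forall>i<m. c i = r * mu i"
    if c: "\<And>i. i < m \<Longrightarrow> c i \<ge> 0" "(\<Sum>i<m. c i *\<^sub>R nK i) = 0" for c
  proof (cases "\<exists>i<m. c i \<noteq> 0")
    case True
    then have nz: "\<exists>i<m. c i *\<^sub>R nK i \<noteq> 0" using n0 by auto
    have "c i *\<^sub>R nK i \<in> normal_cone K (q i)" if "i < m" for i
      using c(1)[OF that] n(1)[OF that] by (rule normal_cone_scaleR[rotated])
    from key[of "\<lambda>i. c i *\<^sub>R nK i", OF this c(2) nz]
    obtain r where r: "r > 0" "\<And>i. i < m \<Longrightarrow> mu i *\<^sub>R nK i = r *\<^sub>R (c i *\<^sub>R nK i)" by blast
    have "c i = (1 / r) * mu i" if "i < m" for i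
    proof -
      have "mu i = r * c i" using r(2)[OF that] n0[OF that] by simp
      then show ?thesis using r(1) by simp
    qed
    then show ?thesis by blast
  qed (auto intro: exI[of _ 0])
  \<comment> \<open>Adding a multiple of \<open>mu\<close> makes the coefficients nonnegative, so
    that the weighted vectors are again outer normals.\<close>
  have rel: "\<exists>r. \<forall>i<m. c i = r * mu i" if c: "(\<Sum>i<m. c i *\<^sub>R nK i) = 0" for c
  proof -
    obtain M where "\<And>i. i < m \<Longrightarrow> c i + M * mu i \<ge> 0"
      using add_multiple_nonneg[of m mu c] mu_pos by blast
    moreover have "(\<Sum>i<m. (c i + M * mu i) *\<^sub>R nK i) = 0"
      using c sum_scaleR_add_relation[OF mu_rel] by simp
    ultimately obtain r where r: "\<And>i. i < m \<Longrightarrow> c i + M * mu i = r * mu i"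
      using nonneg_rel[of "\<lambda>i. c i + M * mu i"] by blast
    have "c i = (r - M) * mu i" if "i < m" for i using r[OF that] by (simp add: algebra_simps)
    then show ?thesis by blast
  qed
  have U: "cone_spanned nK m = span (nK ` {..<m})" by (rule cone_spanned_eq_span[OF mu_pos mu_rel])
  have dimU: "dim (cone_spanned nK m) = m - 1"
    unfolding U by (rule dim_span_one_relation[OF _ mu_pos mu_rel rel]) (use m in auto)
  have "m - 1 \<le> DIM('a)" using dim_subset_UNIV[of "cone_spanned nK m"] dimU by simp
  then have mle: "m \<le> DIM('a) + 1" by simp
  have "dim (normal_cone K (q j) \<inter> cone_spanned nK m) = 1" if j: "j < m" for j
  proof -
    have nj: "nK j \<in> normal_cone K (q j) \<inter> cone_spanned nK m"
      using n(1)[OF j] j by (auto simp: U intro: span_base)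
    \<comment> \<open>Since \<open>U\<close> is both a subspace and a cone, \<open>- v\<close> is a
      nonnegative combination of the normals. Adding \<open>v\<close> at index \<open>j\<close>
      completes it to a family of normals with sum zero, to which \<open>key\<close> applies unless
      all its members vanish.\<close>
    have "v \<in> span {nK j}" if v: "v \<in> normal_cone K (q j) \<inter> cone_spanned nK m" for v
    proof -
      have "- v \<in> cone_spanned nK m" using v by (auto simp: U intro: span_neg)
      then obtain b where b: "- v = (\<Sum>i<m. b i *\<^sub>R nK i)" "\<And>i. i < m \<Longrightarrow> b i \<ge> 0"
        by (auto simp: cone_spanned_def)
      define a where "a i = b i *\<^sub>R nK i + (if i = j then v else 0)" for i
      have an: "a i \<in> normal_cone K (q i)" if "i < m" for i
        using b(2)[OF that] n(1)[OF that] v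
        by (auto simp: a_def intro!: normal_cone_add normal_cone_scaleR)
      have a0: "(\<Sum>i<m. a i) = 0"
        using j by (simp add: a_def sum.distrib flip: b(1))
      have aj: "v = a j - b j *\<^sub>R nK j" by (simp add: a_def)
      show ?thesis
      proof (cases "\<exists>i<m. a i \<noteq> 0")
        case True
        then obtain c where c: "c > 0" "\<And>i. i < m \<Longrightarrow> mu i *\<^sub>R nK i = c *\<^sub>R a i"
          using key[OF an a0] by blast
        have "a j = (1 / c) *\<^sub>R (mu j *\<^sub>R nK j)" using c(1) c(2)[OF j] by simp
        then have "v = (1 / c) *\<^sub>R (mu j *\<^sub>R nK j) - b j *\<^sub>R nK j" using aj by simp
        also have "\<dots> \<in> span {nK j}"
          by (intro span_diff span_scale) (auto intro: span_base)
        finally show ?thesis .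
      next
        case False
        then have "v = - (b j *\<^sub>R nK j)" using aj j by simp
        also have "\<dots> \<in> span {nK j}"
          by (intro span_neg span_scale) (auto intro: span_base)
        finally show ?thesis .
      qed
    qed
    \<comment> \<open>\<open>dim\<close> depends only on the span, here the line through
      \<open>nK j\<close>.\<close>
    then have "span (normal_cone K (q j) \<inter> cone_spanned nK m) = span {nK j}"
      using nj by (metis (no_types, lifting) empty_subsetI insert_subset span_mono span_minimal subsetI subset_antisym subspace_span)
    then have "dim (normal_cone K (q j) \<inter> cone_spanned nK m) = dim {nK j}" by (metis dim_span)
    then show ?thesis using n0[OF j] by simp
  qed
  then show ?thesis using dimU mle by (simp add: U subspace_span)
qed

end
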